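(* Suppose that a function $\mathbf v\in L^\infty(\mathbb R)^N$ can be written as $\mathbf v=\mathbf v_{\mathrm{per}}+\mathbf v_{\mathrm{int}}+\mathbf v_{\mathrm z}$, where $\mathbf v_{\mathrm{per}}\in L^\infty(\mathbb R/L\mathbb Z)^N$ for some $L\in(0,\infty)$, $\mathbf v_{\mathrm{int}}\in(L^1(\mathbb R)\cap L^\infty(\mathbb R))^N$, and $\mathbf v_{\mathrm z}\in L^\infty(\mathbb R)^N$ satisfies $\lim_{|x|\to\infty}|\mathbf v_{\mathrm z}(x)|=0$. Then $\mathbf v\in\mathscr B_{\mathbf a}$, where $\mathbf a=\frac1L\int_0^L\mathbf v_{\mathrm{per}}(x)\,dx$.
   Context: $L^\infty(\mathbb R/L\mathbb Z)$ is the space of $L$-periodic functions in $L^\infty(\mathbb R)$. On $\mathbb R^N$ let $(x_1,\dots,x_N)\preceq(y_1,\dots,y_N)$ mean $x_i\le y_i$ for every $i$; for functions, $\preceq$ is understood pointwise (a.e.). For $\mathbf a\in\mathbb R^N$, $\mathscr B_{\mathbf a}$ is the set of all $\mathbf v\in L^\infty(\mathbb R)^N$ such that for every $\varepsilon>0$ there exist $L_\varepsilon\in(0,\infty)$ and $\mathbf v_-^\varepsilon,\mathbf v_+^\varepsilon\in L^\infty(\mathbb R/L_\varepsilon\mathbb Z)^N$ with $\mathbf v_-^\varepsilon\preceq\mathbf v\preceq\mathbf v_+^\varepsilon$ and $$\frac1{L_\varepsilon}\int_0^{L_\varepsilon}\mathbf v_+^\varepsilon(x)\,dx-(\varepsilon,\dots,\varepsilon)\preceq\mathbf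 a\preceq\frac1{L_\varepsilon}\int_0^{L_\varepsilon}\mathbf v_-^\varepsilon(x)\,dx+(\varepsilon,\dots,\varepsilon).$$ *)

theory Defs
  imports "HOL-Analysis.Analysis"
begin

text \<open>
  The elements of the function spaces below are functions, not equivalence classes modulo
  null sets.  All conditions on them are therefore stated almost everywhere, so that
  membership depends only on the equivalence class.
\<close>

definition Linf :: "(real \<Rightarrow> real) set" where
  "Linf = {f \<in> borel_measurable lebesgue. \<exists>C. AE x in lebesgue. \<bar>f x\<bar> \<le> C}"

definition Linf_per :: "real \<Rightarrow> (real \<Rightarrow> real) set" where
  "Linf_per L = {f \<in> Linf. AE x in lebesgue. f (x + L) = f x}"

definition L1 :: "(real \<Rightarrow> real) set" where
  "L1 = {f. integrable lebesgue f}"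

text \<open>The \<open>N\<close>-th power \<open>X\<^sup>N\<close> of a space \<open>X\<close> of scalar functions, with \<open>N = CARD('n)\<close>.\<close>

definition vec_space :: "(real \<Rightarrow> real) set \<Rightarrow> (real \<Rightarrow> real ^ 'n) set" where
  "vec_space X = {v. \<forall>i. (\<lambda>x. v x $ i) \<in> X}"

definition mean :: "real \<Rightarrow> (real \<Rightarrow> real ^ 'n) \<Rightarrow> real ^ 'n" where
  "mean L v = (1 / L) *\<^sub>R (LINT x:{0..L}|lebesgue. v x)"

text \<open>The library order on \<^typ>\<open>real ^ 'n\<close> is the componentwise one.\<close>

definition \<B> :: "real ^ 'n \<Rightarrow> (real \<Rightarrow> real ^ 'n) set" where
  "\<B> a = {v \<in> vec_space Linf.
     \<forall>\<epsilon>>0. \<exists>L>0. \<exists>vm \<in> vec_space (Linf_per L). \<exists>vp \<in> vec_space (Linf_per L).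
       (AE x in lebesgue. vm x \<le> v x) \<and> (AE x in lebesgue. v x \<le> vp x) \<and>
       mean L vp - (\<chi> i. \<epsilon>) \<le> a \<and> a \<le> mean L vm + (\<chi> i. \<epsilon>)}"

text \<open>
  The limit at infinity of a function known only up to null sets: for every neighbourhood
  \<open>U\<close> of \<open>l\<close> there is an \<open>R\<close> such that \<open>f x \<in> U\<close> for almost every \<open>x\<close> with \<open>\<bar>x\<bar> \<ge> R\<close>.
  It is the ordinary limit at infinity of a suitable representative of \<open>f\<close>.
\<close>

definition ess_tendsto_at_infinity :: "(real \<Rightarrow> real) \<Rightarrow> real \<Rightarrow> bool" where
  "ess_tendsto_at_infinity f l \<longleftrightarrow> (f \<longlongrightarrow> l) (inf at_infinity (ae_filter lebesgue))"

end

theory Submission imports Defs begin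

text \<open>
  Up to an error of size \<open>\<epsilon> / 2\<close>, the non-periodic part is dominated in absolute value by one
  bounded integrable scalar function \<open>g\<close>: outside a large interval \<open>v_z\<close> is small, and inside it is
  bounded.  For \<open>T > 0\<close> the \<open>T\<close>-periodic function \<open>P x = (SUP k. g (x + k T))\<close> dominates \<open>g\<close>, and
  bounding the supremum by the sum over \<open>k\<close> shows that its integral over a period is at most \<open>\<integral> g\<close>.
  Taking \<open>T = n L\<close> with \<open>n\<close> large makes the mean of \<open>P\<close> at most \<open>\<epsilon> / 2\<close>, so
  \<open>v_per \<plusminus> (P + \<epsilon> / 2)\<close> are the required periodic bounds.
\<close>

section \<open>Translation invariance of Lebesgue measure\<close>

lemma measurable_lebesgue_translation:
  fixes t :: real
  shows "(\<lambda>x. x + t) \<in> measurable lebesgue lebesgue"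
  using lebesgue_affine_measurable[where c = "\<lambda>_::real. 1" and t = t] by (simp add: add.commute)

lemma distr_lebesgue_translation:
  fixes t :: real
  shows "distr lebesgue lebesgue (\<lambda>x. x + t) = lebesgue"
  using lebesgue_real_affine[of 1 t] by (simp add: add.commute density_1)

text \<open>Lebesgue measure is its own image under a translation, so the preimage of a null set is
  null.\<close>

lemma AE_lebesgue_translation:
  fixes t :: real
  assumes "AE x in lebesgue. P x"
  shows "AE x in lebesgue. P (x + t)"
  by (rule AE_distrD[OF measurable_lebesgue_translation])
    (simp only: distr_lebesgue_translation assms)

lemma nn_integral_lebesgue_translation:
  fixes f :: "real \<Rightarrow> ennreal"
  assumes "f \<in> borel_measurable lebesgue"
  shows "(\<integral>\<^sup>+x. f (x + t) \<partial>lebesgue) = (\<integral>\<^sup>+x. f x \<partial>lebesgue)"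
  using nn_integral_real_affine_lebesgue[OF assms, of 1 t] by (simp add: add.commute)

lemma AE_lebesgue_neq:
  fixes a :: real
  shows "AE x in lebesgue. x \<noteq> a"
  using AE_lborel_singleton[of a] by (rule AE_completion)

section \<open>Essentially bounded and periodic functions\<close>

lemma Linf_I:
  "f \<in> borel_measurable lebesgue \<Longrightarrow> AE x in lebesgue. \<bar>f x\<bar> \<le> C \<Longrightarrow> f \<in> Linf"
  by (auto simp: Linf_def)

lemma Linf_add:
  assumes "f \<in> Linf" "g \<in> Linf"
  shows "(\<lambda>x. f x + g x) \<in> Linf"
proof -
  obtain C D where CD: "AE x in lebesgue. \<bar>f x\<bar> \<le> C" "AE x in lebesgue. \<bar>g x\<bar> \<le> D"
    using assms by (auto simp: Linf_def)
  have "AE x in lebesgue. \<bar>f x + g x\<bar> \<le> C + D"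
    using CD by eventually_elim linarith
  then show ?thesis
    using assms by (intro Linf_I) (auto simp: Linf_def)
qed

lemma Linf_minus: "f \<in> Linf \<Longrightarrow> (\<lambda>x. - f x) \<in> Linf"
  by (auto simp: Linf_def)

text \<open>Applied to the components of a vector function, this yields one scalar function that
  dominates all of them.\<close>

lemma Linf_sum_abs:
  assumes "finite I" "\<And>i. i \<in> I \<Longrightarrow> f i \<in> Linf"
  shows "(\<lambda>x. \<Sum>i\<in>I. \<bar>f i x\<bar>) \<in> Linf"
  using assms
proof (induction I)
  case empty
  show ?case by (rule Linf_I[where C = 0]) auto
next
  case (insert i I)
  have "(\<lambda>x. \<bar>f i x\<bar>) \<in> Linf"
    using insert.prems[of i] by (auto simp: Linf_def)
  then show ?case
    using insert Linf_add by simp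
qed

text \<open>The interval has finite measure, so the essential bound restricted to it is an
  integrable majorant.\<close>

lemma set_integrable_Linf:
  assumes "f \<in> Linf"
  shows "set_integrable lebesgue {a..b} f"
proof -
  obtain C where C: "AE x in lebesgue. \<bar>f x\<bar> \<le> C" and f: "f \<in> borel_measurable lebesgue"
    using assms by (auto simp: Linf_def)
  have "integrable lebesgue (indicator {a..b} :: real \<Rightarrow> real)"
    using emeasure_lborel_cbox_finite[of a b] by (intro integrable_real_indicator) auto
  then have "integrable lebesgue (\<lambda>x. indicator {a..b} x *\<^sub>R C)"
    by simp
  then show ?thesis
    unfolding set_integrable_def
  proof (rule Bochner_Integration.integrable_bound)
    show "(\<lambda>x. indicator {a..b} x *\<^sub>R f x) \<in> borel_measurable lebesgue"
      using f by (intro borel_measurable_scaleR borel_measurable_indicator) auto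
    show "AE x in lebesgue. norm (indicator {a..b} x *\<^sub>R f x) \<le> norm (indicator {a..b} x *\<^sub>R C)"
      using C by eventually_elim (auto simp: indicator_def)
  qed
qed

lemma Linf_perD:
  assumes "f \<in> Linf_per L"
  shows "f \<in> Linf" "AE x in lebesgue. f (x + L) = f x"
  using assms by (auto simp: Linf_per_def)

lemma Linf_per_add:
  assumes "f \<in> Linf_per L" "g \<in> Linf_per L"
  shows "(\<lambda>x. f x + g x) \<in> Linf_per L"
proof -
  have "AE x in lebesgue. f (x + L) + g (x + L) = f x + g x"
    using Linf_perD(2)[OF assms(1)] Linf_perD(2)[OF assms(2)] by eventually_elim simp
  then show ?thesis
    using assms Linf_add by (auto simp: Linf_per_def)
qed

lemma Linf_per_minus: "f \<in> Linf_per L \<Longrightarrow> (\<lambda>x. - f x) \<in> Linf_per L"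
  by (auto simp: Linf_per_def Linf_minus)

lemma Linf_per_const: "(\<lambda>_. c) \<in> Linf_per L"
  by (auto simp: Linf_per_def intro: Linf_I[where C = "\<bar>c\<bar>"])

text \<open>The induction step uses the period relation at \<open>x + real n * L\<close>; its
  exceptional set there is a translate of a null set, hence null.\<close>

lemma AE_periodic_multiple:
  fixes L :: real
  assumes "AE x in lebesgue. f (x + L) = f x"
  shows "AE x in lebesgue. f (x + real n * L) = f x"
proof (induction n)
  case (Suc n)
  show ?case
    using Suc AE_lebesgue_translation[OF assms, of "real n * L"]
    by eventually_elim (simp add: algebra_simps)
qed simp

lemma Linf_per_multiple: "f \<in> Linf_per L \<Longrightarrow> f \<in> Linf_per (real n * L)"
  by (auto simp: Linf_per_def AE_periodic_multiple)

text \<open>Induction on \<open>n\<close>: the last period is split off and translated back to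
  \<open>{0..L}\<close>.\<close>

lemma set_integral_periodic_multiple:
  assumes f: "f \<in> Linf_per L" and "0 \<le> L"
  shows "(LINT x:{0..real n * L}|lebesgue. f x) = real n * (LINT x:{0..L}|lebesgue. f x)"
proof -
  have meas: "(\<lambda>x. indicator {a..b} x *\<^sub>R f x) \<in> borel_measurable lebesgue" for a b
    using set_integrable_Linf[OF Linf_perD(1)[OF f]]
    unfolding set_integrable_def by (rule borel_measurable_integrable)
  show ?thesis
  proof (induction n)
    case 0
    have "(LINT x:{0..real 0 * L}|lebesgue. f x) = (LINT x::real|lebesgue. 0)"
      unfolding set_lebesgue_integral_def
    proof (rule integral_cong_AE)
      show "(\<lambda>x. indicator {0..real 0 * L} x *\<^sub>R f x) \<in> borel_measurable lebesgue"
        by (rule meas)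
      \<comment> \<open>The interval degenerates to the single point 0, not to the empty
        set.\<close>
      show "AE x in lebesgue. indicator {0..real 0 * L} x *\<^sub>R f x = 0"
        using AE_lebesgue_neq[of 0] by eventually_elim auto
    qed simp
    then show ?case by simp
  next
    case (Suc n)
    let ?a = "real n * L"
    have "{0..real (Suc n) * L} = {0..?a} \<union> {?a..?a + L}"
      using \<open>0 \<le> L\<close> by (subst ivl_disj_un_two_touch) (auto simp: algebra_simps)
    then have "(LINT x:{0..real (Suc n) * L}|lebesgue. f x)
        = (LINT x:{0..?a} \<union> {?a..?a + L}|lebesgue. f x)"
      by simp
    also have "\<dots> = (LINT x:{0..?a}|lebesgue. f x) + (LINT x:{?a..?a + L}|lebesgue. f x)"
    proof (rule set_integral_Un_AE)
      \<comment> \<open>The two closed intervals overlap only in their common endpoint.\<close>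
      show "AE x in lebesgue. \<not> (x \<in> {0..?a} \<and> x \<in> {?a..?a + L})"
        using AE_lebesgue_neq[of ?a] by eventually_elim auto
    qed (auto intro!: set_integrable_Linf Linf_perD(1)[OF f])
    \<comment> \<open>The factor \<open>1\<close> is the slope in the affine change of
      variables.\<close>
    also have "(LINT x:{?a..?a + L}|lebesgue. f x)
        = (LINT x|lebesgue. indicator {?a..?a + L} (?a + 1 * x) *\<^sub>R f (?a + 1 * x))"
      unfolding set_lebesgue_integral_def
      using lebesgue_integral_real_affine[of 1 "\<lambda>x. indicator {?a..?a + L} x *\<^sub>R f x" ?a] by simp
    also have "\<dots> = (LINT x:{0..L}|lebesgue. f x)"
      unfolding set_lebesgue_integral_def
    proof (rule integral_cong_AE)
      show "(\<lambda>x. indicator {?a..?a + L} (?a + 1 * x) *\<^sub>R f (?a + 1 * x)) \<in> borel_measurable lebesgue"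
        using measurable_compose[OF measurable_lebesgue_translation[of ?a],
            OF meas[of ?a "?a + L"]]
        by (simp add: add.commute)
      show "AE x in lebesgue. indicator {?a..?a + L} (?a + 1 * x) *\<^sub>R f (?a + 1 * x)
          = indicator {0..L} x *\<^sub>R f x"
        using AE_periodic_multiple[OF Linf_perD(2)[OF f], of n]
        by eventually_elim (auto simp: indicator_def add.commute)
    qed (rule meas)
    finally show ?case
      using Suc by (simp add: algebra_simps)
  qed
qed

section \<open>Periodic majorants of bounded integrable functions\<close>

text \<open>The supremum is at most the sum over \<open>k\<close>. After exchanging sum and integral
  and substituting \<open>y = x + of_int k * T\<close>, the translates of \<open>{0..<T}\<close>
  tile the line, so the sum recovers the full integral of \<open>g\<close>.\<close>

lemma nn_integral_SUP_translates_le: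
  fixes g :: "real \<Rightarrow> ennreal"
  assumes [measurable]: "g \<in> borel_measurable lebesgue" and "0 < T"
  shows "(\<integral>\<^sup>+x\<in>{0..<T}. (SUP k::int. g (x + of_int k * T)) \<partial>lebesgue) \<le> (\<integral>\<^sup>+x. g x \<partial>lebesgue)"
proof -
  \<comment> \<open>The half-open interval makes the tiling exact: each \<open>y\<close> lies in
    precisely one translate, the one with index \<open>\<lfloor>y / T\<rfloor>\<close>.\<close>
  have ind: "indicator {0..<T} (y - of_int k * T) = (indicator {\<lfloor>y / T\<rfloor>} k :: ennreal)" for y and k :: int
  proof -
    have "\<lfloor>y / T\<rfloor> = k \<longleftrightarrow> y - of_int k * T \<in> {0..<T}"
      using \<open>0 < T\<close> by (auto simp: floor_eq_iff field_simps)
    then show ?thesis by (auto simp: indicator_def)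
  qed
  have "(indicator {0..<T} :: real \<Rightarrow> ennreal) \<in> borel_measurable lebesgue"
    by (rule borel_measurable_indicator) simp
  then have "(\<lambda>y. indicator {0..<T} (y + - (of_int k * T)) :: ennreal) \<in> borel_measurable lebesgue" for k :: int
    by (rule measurable_compose[OF measurable_lebesgue_translation])
  then have meas: "(\<lambda>y. g y * indicator {0..<T} (y - of_int k * T)) \<in> borel_measurable lebesgue" for k :: int
    by (intro borel_measurable_times_ennreal) simp_all
  have gt: "(\<lambda>x. g (x + of_int k * T)) \<in> borel_measurable lebesgue" for k :: int
    by (rule measurable_compose[OF measurable_lebesgue_translation assms(1)])
  have "(\<integral>\<^sup>+x\<in>{0..<T}. (SUP k::int. g (x + of_int k * T)) \<partial>lebesgue)
      \<le> (\<integral>\<^sup>+x. (\<integral>\<^sup>+k. g (x + of_int k * T) * indicator {0..<T} x \<partial>count_space (UNIV :: int set)) \<partial>lebesgue)"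
  proof (rule nn_integral_mono)
    fix x
    have "(SUP k::int. g (x + of_int k * T)) \<le> (\<integral>\<^sup>+k. g (x + of_int k * T) \<partial>count_space (UNIV :: int set))"
      by (intro SUP_least nn_integral_ge_point) simp
    then show "(SUP k::int. g (x + of_int k * T)) * indicator {0..<T} x
        \<le> (\<integral>\<^sup>+k. g (x + of_int k * T) * indicator {0..<T} x \<partial>count_space (UNIV :: int set))"
      by (simp add: nn_integral_multc mult_right_mono)
  qed
  \<comment> \<open>Tonelli, with the sum written as an integral against counting measure on the
    integers.\<close>
  also have "\<dots> = (\<integral>\<^sup>+k. (\<integral>\<^sup>+x. g (x + of_int k * T) * indicator {0..<T} x \<partial>lebesgue) \<partial>count_space (UNIV :: int set))"
    by (intro nn_integral_count_space_nn_integral borel_measurable_times_ennreal gt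
        borel_measurable_indicator) auto
  also have "\<dots> = (\<integral>\<^sup>+k. (\<integral>\<^sup>+y. g y * indicator {0..<T} (y - of_int k * T) \<partial>lebesgue) \<partial>count_space (UNIV :: int set))"
  proof (rule nn_integral_cong)
    fix k :: int
    show "(\<integral>\<^sup>+x. g (x + of_int k * T) * indicator {0..<T} x \<partial>lebesgue)
        = (\<integral>\<^sup>+y. g y * indicator {0..<T} (y - of_int k * T) \<partial>lebesgue)"
      using nn_integral_lebesgue_translation[OF meas[of k], of "of_int k * T"] by simp
  qed
  also have "\<dots> = (\<integral>\<^sup>+y. (\<integral>\<^sup>+k. g y * indicator {0..<T} (y - of_int k * T) \<partial>count_space (UNIV :: int set)) \<partial>lebesgue)"
    by (intro nn_integral_count_space_nn_integral[symmetric] meas) auto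
  \<comment> \<open>For fixed \<open>y\<close>, only one \<open>k\<close> contributes.\<close>
  also have "\<dots> = (\<integral>\<^sup>+y. g y \<partial>lebesgue)"
    unfolding ind by (simp add: nn_integral_cmult)
  finally show ?thesis .
qed

text \<open>The supremum of all translates of \<open>g\<close> by multiples of \<open>T\<close>
  works. The bound \<open>C\<close> makes it a genuine real supremum and puts it in
  \<open>Linf\<close>; countability of the index set makes it measurable.\<close>

lemma periodic_majorant:
  fixes g :: "real \<Rightarrow> real"
  assumes g: "integrable lebesgue g" and nonneg: "\<And>x. 0 \<le> g x" and le: "\<And>x. g x \<le> C"
    and "0 < T"
  obtains P where "P \<in> Linf_per T" "\<And>x. g x \<le> P x"
    "(LINT x:{0..T}|lebesgue. P x) \<le> (LINT x|lebesgue. g x)"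
proof
  define P where "P x = (SUP k::int. g (x + of_int k * T))" for x
  have [measurable]: "g \<in> borel_measurable lebesgue" using g by simp
  have bdd: "bdd_above (range (\<lambda>k::int. g (x + of_int k * T)))" for x
    using le by (intro bdd_aboveI2)
  have gt: "(\<lambda>x. g (x + of_int k * T)) \<in> borel_measurable lebesgue" for k :: int
    using g by (intro measurable_compose[OF measurable_lebesgue_translation]) simp
  have Pm [measurable]: "P \<in> borel_measurable lebesgue"
    unfolding P_def using bdd gt by (intro borel_measurable_cSUP) auto
  \<comment> \<open>The translate with index 0 is \<open>g\<close> itself.\<close>
  show gP: "g x \<le> P x" for x
    unfolding P_def using cSUP_upper[OF _ bdd[of x], of 0] by simp
  have P0: "0 \<le> P x" for x
    using nonneg[of x] gP[of x] by simp
  have PC: "P x \<le> C" for x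
    unfolding P_def using le by (intro cSUP_least) auto
  have "P (x + T) = P x" for x
  proof -
    \<comment> \<open>Shifting the argument by \<open>T\<close> only reindexes the family by the
      bijection \<open>k + 1\<close> of the integers.\<close>
    have "range (\<lambda>k::int. g (x + T + of_int k * T)) = (\<lambda>k::int. g (x + of_int k * T)) ` range (\<lambda>k. k + 1)"
      unfolding image_image by (intro image_cong refl arg_cong[where f = g]) (simp add: algebra_simps)
    moreover have "range (\<lambda>k::int. k + 1) = UNIV"
      by (rule surjI[where f = "\<lambda>k. k - 1"]) simp
    ultimately show ?thesis
      by (simp add: P_def)
  qed
  then show Pper: "P \<in> Linf_per T"
    using Pm P0 PC by (auto simp: Linf_per_def intro!: Linf_I[where C = C])
  \<comment> \<open>To apply the extended-valued estimate, \<open>ennreal\<close> must commute with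
    the supremum; it does so for bounded nonempty sets, being monotone and continuous.\<close>
  have eP: "ennreal (P x) = (SUP k::int. ennreal (g (x + of_int k * T)))" for x
  proof -
    have "continuous (at_left y) ennreal" for y
      unfolding continuous_within by (intro tendsto_ennrealI tendsto_ident_at)
    then have "ennreal (Sup (range (\<lambda>k::int. g (x + of_int k * T))))
        = Sup (ennreal ` range (\<lambda>k::int. g (x + of_int k * T)))"
      using bdd[of x] by (intro continuous_at_Sup_mono) (auto intro: monoI ennreal_leI)
    then show ?thesis
      by (simp add: P_def image_image)
  qed
  have "(LINT x:{0..T}|lebesgue. P x) = enn2real (\<integral>\<^sup>+x. ennreal (indicator {0..T} x *\<^sub>R P x) \<partial>lebesgue)"
    unfolding set_lebesgue_integral_def
    using P0 set_integrable_Linf[OF Linf_perD(1)[OF Pper], of 0 T]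
    by (intro integral_eq_nn_integral)
      (auto simp: set_integrable_def dest: borel_measurable_integrable)
  also have "(\<integral>\<^sup>+x. ennreal (indicator {0..T} x *\<^sub>R P x) \<partial>lebesgue)
      = (\<integral>\<^sup>+x\<in>{0..<T}. (SUP k::int. ennreal (g (x + of_int k * T))) \<partial>lebesgue)"
    \<comment> \<open>Dropping the endpoint \<open>T\<close> passes from the closed interval of the
      mean to the half-open tile.\<close>
    using AE_lebesgue_neq[of T]
    by (intro nn_integral_cong_AE, eventually_elim) (auto simp: indicator_def eP)
  \<comment> \<open>Monotonicity of \<open>enn2real\<close> requires a finite right-hand side, which
    integrability of \<open>g\<close> supplies.\<close>
  also have "enn2real \<dots> \<le> enn2real (\<integral>\<^sup>+x. ennreal (g x) \<partial>lebesgue)"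
    using nn_integral_SUP_translates_le[of "\<lambda>x. ennreal (g x)" T] \<open>0 < T\<close> g nonneg
    by (intro enn2real_mono) (auto simp: nn_integral_eq_integral)
  also have "\<dots> = (LINT x|lebesgue. g x)"
    using nonneg by (intro integral_eq_nn_integral[symmetric]) auto
  finally show "(LINT x:{0..T}|lebesgue. P x) \<le> (LINT x|lebesgue. g x)" .
qed

section \<open>Componentwise integrals and means\<close>

text \<open>Expanding \<open>f\<close> in the standard basis reduces integrability to the
  components; the coordinate projections, being bounded linear, commute with the integral.\<close>

lemma vec_integral_nth:
  fixes f :: "'a \<Rightarrow> real ^ 'n"
  assumes "\<And>i. integrable M (\<lambda>x. f x $ i)"
  shows "integrable M f" "(LINT x|M. f x) $ i = (LINT x|M. f x $ i)"
proof -
  have "integrable M (\<lambda>x. \<Sum>i\<in>UNIV. (f x $ i) *\<^sub>R axis i (1::real))"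
    using assms by (intro Bochner_Integration.integrable_sum integrable_scaleR_left) auto
  also have "(\<lambda>x. \<Sum>i\<in>UNIV. (f x $ i) *\<^sub>R axis i (1::real)) = f"
    by (auto simp: fun_eq_iff vec_eq_iff axis_def if_distrib cong: if_cong)
  finally show f: "integrable M f" .
  show "(LINT x|M. f x) $ i = (LINT x|M. f x $ i)"
    using integral_bounded_linear[OF bounded_linear_vec_nth f, of i] by simp
qed

lemma mean_nth:
  assumes "f \<in> vec_space Linf"
  shows "mean L f $ i = (LINT x:{0..L}|lebesgue. f x $ i) / L"
proof -
  have "integrable lebesgue (\<lambda>x. (indicator {0..L} x *\<^sub>R f x) $ j)" for j
    using set_integrable_Linf[of "\<lambda>x. f x $ j" 0 L] assms
    by (simp add: vec_space_def set_integrable_def)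
  then show ?thesis
    unfolding mean_def set_lebesgue_integral_def by (simp add: vec_integral_nth)
qed

text \<open>Passing from \<open>L\<close> to \<open>real n * L\<close> leaves the mean of
  \<open>f\<close> unchanged, so the mean of \<open>Q\<close> is the whole deviation. It is used
  with a periodic error bound and with its negative.\<close>

lemma mean_add_nth:
  assumes f: "f \<in> vec_space (Linf_per L)" and Q: "Q \<in> Linf" and "0 < L" "0 < n"
  shows "mean (real n * L) (\<lambda>x. \<chi> i. f x $ i + Q x) $ i
    = mean L f $ i + (LINT x:{0..real n * L}|lebesgue. Q x) / (real n * L)"
proof -
  have fi: "(\<lambda>x. f x $ j) \<in> Linf_per L" for j
    using f by (simp add: vec_space_def)
  have "(\<lambda>x. \<chi> i. f x $ i + Q x) \<in> vec_space Linf" "f \<in> vec_space Linf"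
    using Linf_perD(1)[OF fi] Q by (auto simp: vec_space_def intro: Linf_add)
  moreover have "(LINT x:{0..real n * L}|lebesgue. f x $ i + Q x)
      = (LINT x:{0..real n * L}|lebesgue. f x $ i) + (LINT x:{0..real n * L}|lebesgue. Q x)"
    using Linf_perD(1)[OF fi] Q by (intro set_integral_add set_integrable_Linf) auto
  moreover have "(LINT x:{0..real n * L}|lebesgue. f x $ i) = real n * (LINT x:{0..L}|lebesgue. f x $ i)"
    using \<open>0 < L\<close> by (intro set_integral_periodic_multiple fi) auto
  ultimately show ?thesis
    using assms by (simp add: mean_nth add_divide_distrib)
qed

section \<open>Domination of the non-periodic part\<close>

text \<open>Far out, \<open>z\<close> is below \<open>\<delta>\<close>; on the remaining bounded
  interval it is essentially bounded, hence integrable there, and can be absorbed into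
  \<open>g\<close> together with \<open>u\<close>.\<close>

lemma L1_plus_small_majorant:
  fixes u z :: "real \<Rightarrow> real ^ 'n"
  assumes u: "u \<in> vec_space (L1 \<inter> Linf)" and z: "z \<in> vec_space Linf"
    and lim: "ess_tendsto_at_infinity (\<lambda>x. norm (z x)) 0" and "0 < \<delta>"
  obtains g C where "integrable lebesgue g" "\<And>x. 0 \<le> g x" "\<And>x. g x \<le> C"
    "AE x in lebesgue. \<forall>i. \<bar>u x $ i + z x $ i\<bar> \<le> g x + \<delta>"
proof -
  define su sz where "su x = (\<Sum>i\<in>UNIV. \<bar>u x $ i\<bar>)" and "sz x = (\<Sum>i\<in>UNIV. \<bar>z x $ i\<bar>)" for x
  have "su \<in> Linf" "sz \<in> Linf"
    unfolding su_def sz_def using u z by (auto intro!: Linf_sum_abs simp: vec_space_def)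
  then obtain C D where C: "AE x in lebesgue. \<bar>su x\<bar> \<le> C" and D: "AE x in lebesgue. \<bar>sz x\<bar> \<le> D"
    and [measurable]: "su \<in> borel_measurable lebesgue" "sz \<in> borel_measurable lebesgue"
    by (auto simp: Linf_def)
  have "integrable lebesgue su"
    unfolding su_def using u by (auto simp: vec_space_def L1_def)
  have "eventually (\<lambda>x. dist (norm (z x)) 0 < \<delta>) (inf at_infinity (ae_filter lebesgue))"
    using lim \<open>0 < \<delta>\<close> unfolding ess_tendsto_at_infinity_def tendsto_iff by blast
  \<comment> \<open>An event in the infimum of two filters splits into a condition \<open>A\<close>
    valid far out and a condition \<open>B\<close> valid almost everywhere.\<close>
  then obtain A B where "eventually A at_infinity" and B: "AE x in lebesgue. B x"
    and AB: "\<And>x. A x \<Longrightarrow> B x \<Longrightarrow> norm (z x) < \<delta>"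
    unfolding eventually_inf by auto
  then obtain R where R: "\<And>x. R \<le> norm x \<Longrightarrow> A x"
    unfolding eventually_at_infinity by blast
  \<comment> \<open>Truncation at the essential bounds changes the sums only on a null set but
    bounds \<open>g\<close> everywhere; the absolute values make \<open>0 \<le> g x\<close>
    immediate. The indicator makes the \<open>z\<close> part integrable.\<close>
  define g where "g x = (min \<bar>C\<bar> (su x)) + (min \<bar>D\<bar> (sz x)) * indicator {-R..R} x" for x
  have su0: "0 \<le> su x" "0 \<le> sz x" for x
    by (auto simp: su_def sz_def sum_nonneg)
  show ?thesis
  proof
    have "integrable lebesgue (\<lambda>x. min \<bar>C\<bar> (su x))"
      by (rule Bochner_Integration.integrable_bound[OF \<open>integrable lebesgue su\<close>]) (auto simp: su0)
    moreover have "integrable lebesgue (\<lambda>x. min \<bar>D\<bar> (sz x) * indicator {-R..R} x)"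
      using set_integrable_Linf[of "\<lambda>x. min \<bar>D\<bar> (sz x)" "-R" R]
      by (simp add: set_integrable_def mult.commute Linf_I[where C = "\<bar>D\<bar>"] su0)
    ultimately show "integrable lebesgue g"
      unfolding g_def by simp
    show "0 \<le> g x" for x
      by (auto simp: g_def su0)
    show "g x \<le> \<bar>C\<bar> + \<bar>D\<bar>" for x
      by (auto simp: g_def indicator_def intro!: add_mono min.coboundedI1)
    show "AE x in lebesgue. \<forall>i. \<bar>u x $ i + z x $ i\<bar> \<le> g x + \<delta>"
      using C D B
    proof eventually_elim
      case (elim x)
      show ?case
      proof
        fix i
        have "\<bar>u x $ i\<bar> \<le> su x" "\<bar>z x $ i\<bar> \<le> sz x"
          unfolding su_def sz_def by (rule member_le_sum; simp)+
        \<comment> \<open>Outside the interval, \<open>R \<le> norm x\<close>, so the smallness at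
          infinity applies; inside it the indicator keeps \<open>sz x\<close> in
          \<open>g\<close>.\<close>
        moreover have "\<bar>z x $ i\<bar> \<le> \<delta>" if "x \<notin> {-R..R}"
          using AB[OF R[of x]] elim that component_le_norm_cart[of "z x" i] by fastforce
        ultimately show "\<bar>u x $ i + z x $ i\<bar> \<le> g x + \<delta>"
          using elim \<open>0 < \<delta>\<close> by (auto simp: g_def indicator_def)
      qed
    qed
  qed
qed

section \<open>Construction of the periodic bounds\<close>

theorem proposition1p4:
  fixes v v_per v_int v_z :: "real \<Rightarrow> real ^ 'n" and L :: real
  assumes "v \<in> vec_space Linf"
    and "AE x in lebesgue. v x = v_per x + v_int x + v_z x"
    and "0 < L" and "v_per \<in> vec_space (Linf_per L)"
    and "v_int \<in> vec_space (L1 \<inter> Linf)"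
    and "v_z \<in> vec_space Linf"
    and "ess_tendsto_at_infinity (\<lambda>x. norm (v_z x)) 0"
  shows "v \<in> \<B> (mean L v_per)"
proof -
  have "\<exists>T>0. \<exists>vm \<in> vec_space (Linf_per T). \<exists>vp \<in> vec_space (Linf_per T).
       (AE x in lebesgue. vm x \<le> v x) \<and> (AE x in lebesgue. v x \<le> vp x) \<and>
       mean T vp - (\<chi> i. \<epsilon>) \<le> mean L v_per \<and> mean L v_per \<le> mean T vm + (\<chi> i. \<epsilon>)"
    if "0 < \<epsilon>" for \<epsilon>
  proof -
    obtain g C where g: "integrable lebesgue g" "\<And>x. 0 \<le> g x" "\<And>x. g x \<le> C"
      and gb: "AE x in lebesgue. \<forall>i. \<bar>v_int x $ i + v_z x $ i\<bar> \<le> g x + \<epsilon> / 2"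
      using L1_plus_small_majorant[OF assms(5,6,7), of "\<epsilon> / 2"] \<open>0 < \<epsilon>\<close> by auto
    let ?I = "LINT x|lebesgue. g x"
    \<comment> \<open>Chosen so that \<open>?I / (real n * L)\<close>, which bounds the mean of the
      periodic majorant, stays below \<open>\<epsilon> / 2\<close>.\<close>
    obtain n :: nat where n: "2 * ?I / (\<epsilon> * L) < real n"
      using reals_Archimedean2 by blast
    have "0 \<le> ?I"
      using g by simp
    then have "0 \<le> 2 * ?I / (\<epsilon> * L)"
      using \<open>0 < \<epsilon>\<close> \<open>0 < L\<close> by simp
    with n have "0 < n"
      by linarith
    define T where "T = real n * L"
    have "0 < T"
      using \<open>0 < n\<close> \<open>0 < L\<close> by (simp add: T_def)
    have IT: "?I / T \<le> \<epsilon> / 2"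
      using n \<open>0 < \<epsilon>\<close> \<open>0 < L\<close> \<open>0 < T\<close> by (simp add: T_def field_simps)
    obtain P where P: "P \<in> Linf_per T" "\<And>x. g x \<le> P x" "(LINT x:{0..T}|lebesgue. P x) \<le> ?I"
      using periodic_majorant[OF g \<open>0 < T\<close>] by blast
    \<comment> \<open>\<open>P\<close> absorbs the integrable majorant \<open>g\<close>, the
      constant absorbs the remaining error; each contributes at most \<open>\<epsilon> / 2\<close>
      to the mean.\<close>
    define Q where "Q x = P x + \<epsilon> / 2" for x
    have Q: "Q \<in> Linf_per T"
      unfolding Q_def by (intro Linf_per_add P Linf_per_const)
    have "(LINT x:{0..T}|lebesgue. Q x) = (LINT x:{0..T}|lebesgue. P x) + T * (\<epsilon> / 2)"
      unfolding Q_def using \<open>0 < T\<close>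
      by (subst set_integral_add) (auto intro!: set_integrable_Linf Linf_perD(1)[OF P(1)]
          Linf_perD(1)[OF Linf_per_const] simp: set_integral_const)
    then have "(LINT x:{0..T}|lebesgue. Q x) / T \<le> ?I / T + \<epsilon> / 2"
      using P(3) \<open>0 < T\<close> by (simp add: field_simps)
    then have Qmean: "(LINT x:{0..T}|lebesgue. Q x) / T \<le> \<epsilon>"
      using IT by linarith
    have bound: "AE x in lebesgue. \<forall>i. \<bar>v x $ i - v_per x $ i\<bar> \<le> Q x"
      using assms(2) gb
    proof eventually_elim
      case (elim x)
      show ?case
      proof
        fix i
        have "v x $ i - v_per x $ i = v_int x $ i + v_z x $ i"
          using elim(1) by simp
        then show "\<bar>v x $ i - v_per x $ i\<bar> \<le> Q x"
          using elim(2)[rule_format, of i] P(2)[of x] unfolding Q_def by linarith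
      qed
    qed
    \<comment> \<open>Writing the lower bound with \<open>+ - Q x\<close> lets the sum rules for
      periodicity and means apply directly to \<open>- Q\<close>.\<close>
    define vp vm :: "real \<Rightarrow> real ^ 'n"
      where "vp x = (\<chi> i. v_per x $ i + Q x)" and "vm x = (\<chi> i. v_per x $ i + - Q x)" for x
    have "vp \<in> vec_space (Linf_per T)" "vm \<in> vec_space (Linf_per T)"
    proof -
      \<comment> \<open>\<open>T\<close> is a multiple of \<open>L\<close>, so \<open>v_per\<close>
        and \<open>Q\<close> share this period.\<close>
      have "(\<lambda>x. v_per x $ i) \<in> Linf_per T" for i
        using assms(4) unfolding T_def by (intro Linf_per_multiple) (simp add: vec_space_def)
      from Linf_per_add[OF this Q] Linf_per_add[OF this Linf_per_minus[OF Q]]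
      show "vp \<in> vec_space (Linf_per T)" "vm \<in> vec_space (Linf_per T)"
        by (simp_all add: vec_space_def vp_def vm_def)
    qed
    moreover have "AE x in lebesgue. vm x \<le> v x"
      using bound by eventually_elim (auto simp: less_eq_vec_def vm_def abs_le_iff algebra_simps)
    moreover have "AE x in lebesgue. v x \<le> vp x"
      using bound by eventually_elim (auto simp: less_eq_vec_def vp_def abs_le_iff algebra_simps)
    moreover have "mean T vp - (\<chi> i. \<epsilon>) \<le> mean L v_per"
      unfolding less_eq_vec_def
      using Qmean mean_add_nth[OF assms(4) Linf_perD(1)[OF Q] \<open>0 < L\<close> \<open>0 < n\<close>]
      by (simp add: vp_def[abs_def] T_def)
    moreover have "(LINT x:{0..T}|lebesgue. - Q x) = - (LINT x:{0..T}|lebesgue. Q x)"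
      by (simp add: set_lebesgue_integral_def)
    then have "mean L v_per \<le> mean T vm + (\<chi> i. \<epsilon>)"
      unfolding less_eq_vec_def
      using Qmean mean_add_nth[OF assms(4) Linf_minus[OF Linf_perD(1)[OF Q]] \<open>0 < L\<close> \<open>0 < n\<close>]
      by (simp add: vm_def[abs_def] T_def)
    ultimately show ?thesis
      using \<open>0 < T\<close> by blast
  qed
  then show ?thesis
    using assms(1) unfolding \<B>_def by blast
qed

end
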